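(* For every decreasing function $f \colon (0,1) \rightarrow \mathbb{N}$ satisfying $f(x) \geq 1/x$, there is a monotone graph property $\mathcal{P}$ so that: 1. $\mathcal{P}$ has $1$-sided error query complexity $w_{\mathcal{P}}(\varepsilon) \geq f(\varepsilon)$. 2. $\mathcal{P}$ has $2$-sided error query complexity $q_{\mathcal{P}}(\varepsilon,n) = \mathrm{poly}(1/\varepsilon)$ for every $n \geq n_0(\varepsilon)$.
   Context: A graph property is monotone if it is closed under removal of vertices and edges. An $n$-vertex graph $G$ is $\varepsilon$-far from $\mathcal{P}$ if one must remove at least $\varepsilon n^2$ edges from $G$ to make it satisfy $\mathcal{P}$. For a monotone graph property $\mathcal{P}$ and $\varepsilon\in(0,1)$, $w_{\mathcal{P}}(\varepsilon)$ is the smallest positive integer $w$ such that for every sufficiently large graph $G$ which is $\varepsilon$-far from satisfying $\mathcal{P}$, a uniformly random set $S$ of $w$ vertices of $G$ is such that the induced subgraph $G[S]$ does not satisfy $\mathcal{P}$ with probability at least $2/3$. For monotone $\mathcal{P}$ this equals the query complexity of the optimal $1$-sided error $\varepsilon$-tester (one that accepts graphs satisfying $\mathcal{P}$ with probability $1$ and rejects graphs that are $\varepsilon$-far from $\mathcal{P}$ with probability at least $2/3$). An $\varepsilon$-tester for $\mathcal{P}$ is a (randomized) algorithm which samples a uniformly random set $S$ of vertices of the input graph $G$ and, based on the induced subgraph $G[S]$, distinguishes with probability at least $2/3$ between the case that $G$ satisfies $\mathcal{P}$ and the case that $G$ is $\varepsilon$-far from satisfying $\mathcal{P}$; it may err in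 both directions ($2$-sided error). $q_{\mathcal{P}}(\varepsilon,n)$ is the smallest integer $q$ for which there is an $\varepsilon$-tester for $\mathcal{P}$ that works by randomly selecting a set of $q$ vertices from $n$-vertex graphs. The notation $\mathrm{poly}(1/\varepsilon)$ means bounded from above by a polynomial in $1/\varepsilon$ (with no dependence on $n$), and $n_0(\varepsilon)$ is a threshold depending on $\varepsilon$ (and on $\mathcal{P}$).
   Formalization: Item 1 is claimed only for ε < 1/4 instead of all ε in (0,1): for ε ≥ 1/2 it fails for every f, and for 1/4 ≤ ε < 1/2 it fails whenever f grows faster than every polynomial in 1/ε. *)

theory Defs
  imports
    "HOL-Probability.Probability"
    "HOL-Computational_Algebra.Polynomial"
    "HOL-Library.Extended_Nat"
begin

text \<open>
  Every finite simple graph is isomorphic to one whose vertices are natural numbers, so graphs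
  are pairs of a vertex set and an edge set over \<^typ>\<open>nat\<close>.
\<close>

type_synonym ugraph = "nat set \<times> nat set set"

abbreviation verts :: "ugraph \<Rightarrow> nat set" where "verts \<equiv> fst"
abbreviation edges :: "ugraph \<Rightarrow> nat set set" where "edges \<equiv> snd"

definition simple_graph :: "ugraph \<Rightarrow> bool" where
  "simple_graph G \<longleftrightarrow>
     finite (verts G) \<and> (\<forall>e\<in>edges G. e \<subseteq> verts G \<and> card e = 2)"

definition induced :: "ugraph \<Rightarrow> nat set \<Rightarrow> ugraph" where
  "induced G S = (S, {e \<in> edges G. e \<subseteq> S})"

definition remove_edges :: "ugraph \<Rightarrow> nat set set \<Rightarrow> ugraph" where
  "remove_edges G F = (verts G, edges G - F)"

definition isomorphic_graphs :: "ugraph \<Rightarrow> ugraph \<Rightarrow> bool" where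
  "isomorphic_graphs G H \<longleftrightarrow>
     (\<exists>h. bij_betw h (verts G) (verts H) \<and> edges H = (\<lambda>e. h ` e) ` edges G)"

text \<open>
  Properties are predicates on \<^typ>\<open>ugraph\<close>; their values on pairs that are not simple
  graphs are never used.
\<close>

definition graph_property :: "(ugraph \<Rightarrow> bool) \<Rightarrow> bool" where
  "graph_property P \<longleftrightarrow>
     (\<forall>G H. simple_graph G \<longrightarrow> simple_graph H \<longrightarrow> isomorphic_graphs G H \<longrightarrow> P G \<longrightarrow> P H)"

definition monotone_graph_property :: "(ugraph \<Rightarrow> bool) \<Rightarrow> bool" where
  "monotone_graph_property P \<longleftrightarrow> graph_property P \<and>
     (\<forall>G. simple_graph G \<longrightarrow> P G \<longrightarrow>
        (\<forall>S\<subseteq>verts G. P (induced G S)) \<and> (\<forall>F\<subseteq>edges G. P (remove_edges G F)))"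

definition eps_far :: "(ugraph \<Rightarrow> bool) \<Rightarrow> real \<Rightarrow> ugraph \<Rightarrow> bool" where
  "eps_far P \<epsilon> G \<longleftrightarrow>
     (\<forall>F\<subseteq>edges G. P (remove_edges G F) \<longrightarrow> \<epsilon> * real (card (verts G)) ^ 2 \<le> real (card F))"

text \<open>A uniformly random set of \<open>q\<close> vertices; only meaningful if \<open>G\<close> has at least \<open>q\<close> vertices.\<close>

definition random_vertices :: "ugraph \<Rightarrow> nat \<Rightarrow> nat set pmf" where
  "random_vertices G q = pmf_of_set {S. S \<subseteq> verts G \<and> card S = q}"

definition one_sided_sample :: "(ugraph \<Rightarrow> bool) \<Rightarrow> real \<Rightarrow> nat \<Rightarrow> bool" where
  "one_sided_sample P \<epsilon> w \<longleftrightarrow>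
     (\<exists>N\<ge>w. \<forall>G. simple_graph G \<longrightarrow> card (verts G) \<ge> N \<longrightarrow> eps_far P \<epsilon> G \<longrightarrow>
        measure_pmf.prob (random_vertices G w) {S. \<not> P (induced G S)} \<ge> 2 / 3)"

text \<open>The smallest suitable sample size, or \<open>\<infinity>\<close> if there is none.\<close>

definition one_sided_complexity :: "(ugraph \<Rightarrow> bool) \<Rightarrow> real \<Rightarrow> enat" where
  "one_sided_complexity P \<epsilon> = Inf (enat ` {w. w > 0 \<and> one_sided_sample P \<epsilon> w})"

text \<open>
  A tester is an arbitrary randomized decision \<open>D\<close> (\<^const>\<open>True\<close> meaning accept) applied to the
  sampled induced subgraph. The probability below is over both the sample and the coins of \<open>D\<close>.
\<close>

definition output_prob :: "(ugraph \<Rightarrow> bool pmf) \<Rightarrow> ugraph \<Rightarrow> nat \<Rightarrow> bool \<Rightarrow> real" where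
  "output_prob D G q b = pmf (bind_pmf (random_vertices G q) (\<lambda>S. D (induced G S))) b"

definition eps_tester ::
  "(ugraph \<Rightarrow> bool) \<Rightarrow> real \<Rightarrow> nat \<Rightarrow> nat \<Rightarrow> (ugraph \<Rightarrow> bool pmf) \<Rightarrow> bool" where
  "eps_tester P \<epsilon> n q D \<longleftrightarrow> q \<le> n \<and>
     (\<forall>G. simple_graph G \<longrightarrow> card (verts G) = n \<longrightarrow>
        (P G \<longrightarrow> output_prob D G q True \<ge> 2 / 3) \<and>
        (eps_far P \<epsilon> G \<longrightarrow> output_prob D G q False \<ge> 2 / 3))"

text \<open>For \<open>n > 0\<close> and \<open>\<epsilon> > 0\<close> the minimum exists, since \<open>q = n\<close> reveals the whole graph.\<close>

definition two_sided_complexity :: "(ugraph \<Rightarrow> bool) \<Rightarrow> real \<Rightarrow> nat \<Rightarrow> nat" where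
  "two_sided_complexity P \<epsilon> n = (LEAST q. \<exists>D. eps_tester P \<epsilon> n q D)"

end

theory Submission
  imports Defs
begin

text \<open>
  Let \<open>P\<close> hold for \<open>G\<close> when every set of at most \<open>h (card (verts G))\<close> vertices of \<open>G\<close> induces a
  bipartite graph, where \<open>h\<close> is nondecreasing and unbounded but grows very slowly. Bipartite graphs
  satisfy \<open>P\<close>, so being far from \<open>P\<close> implies being far from bipartite, and the argument of
  Goldreich, Goldwasser and Ron shows that a sample of \<open>poly (1 / \<epsilon>)\<close> vertices is then
  non-bipartite with probability at least \<open>2 / 3\<close>. Once \<open>h n\<close> exceeds the sample size, a graph in
  \<open>P\<close> never yields a non-bipartite sample, so testing the sample for bipartiteness is a two-sided
  tester. On the other hand, a sample of \<open>w\<close> vertices violates \<open>P\<close> only if some \<open>h w\<close> of its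
  vertices induce a non-bipartite graph, and in a blow-up of an odd cycle of length \<open>L\<close>, which is
  \<open>1 / L\<^sup>2\<close>-far from bipartite, this forces \<open>h w \<ge> L\<close>. Letting \<open>h\<close> grow slowly enough in terms of
  \<open>f\<close> makes \<open>w \<ge> f \<epsilon>\<close>. For \<open>\<epsilon>\<close> close to \<open>1 / 4\<close> complete graphs replace the blow-ups.
\<close>

section \<open>Testing bipartiteness\<close>

definition two_colourable :: "nat set set \<Rightarrow> nat set \<Rightarrow> bool" where
  "two_colourable E T \<longleftrightarrow> (\<exists>X. \<forall>x\<in>T. \<forall>y\<in>T. {x, y} \<in> E \<longrightarrow> (x \<in> X) \<noteq> (y \<in> X))"

definition monochromatic :: "nat set set \<Rightarrow> nat set \<Rightarrow> nat set set" where
  "monochromatic E X = {e \<in> E. e \<subseteq> X \<or> e \<inter> X = {}}"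

text \<open>The cheapest way to make a cut a proper colouring is to delete the edges that do not
  cross it. Quantifying over cuts therefore gives the distance to bipartiteness without mentioning
  edge deletions.\<close>

definition far_from_bipartite :: "real \<Rightarrow> ugraph \<Rightarrow> bool" where
  "far_from_bipartite \<epsilon> G \<longleftrightarrow>
     (\<forall>X. \<epsilon> * real (card (verts G)) ^ 2 \<le> real (card (monochromatic (edges G) X)))"

text \<open>Samples with repetition: their entries are independent, so counts become products.
  \<open>prob_random_vertices_le\<close> transfers the bounds to random sets.\<close>

definition lists_of :: "nat set \<Rightarrow> nat \<Rightarrow> nat list set" where
  "lists_of V k = {xs. set xs \<subseteq> V \<and> length xs = k}"

text \<open>
  Edges \<open>(x, y)\<close> about which a colouring of \<open>U\<close> says nothing, because \<open>x\<close> has no neighbour in \<open>U\<close>.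
\<close>

definition uncovered :: "nat set set \<Rightarrow> nat set \<Rightarrow> nat set \<Rightarrow> (nat \<times> nat) set" where
  "uncovered E V U = {(x, y). x \<in> V \<and> y \<in> V \<and> {x, y} \<in> E \<and> (\<forall>z\<in>U. {x, z} \<notin> E)}"

text \<open>
  Edges that rule out every proper colouring whose restriction to \<open>U\<close> has colour class \<open>C\<close>:
  their ends have neighbours of the same colour, which forces both ends into the other class.
\<close>

definition witnesses :: "nat set set \<Rightarrow> nat set \<Rightarrow> nat set \<Rightarrow> nat set \<Rightarrow> (nat \<times> nat) set" where
  "witnesses E V U C = {(x, y). x \<in> V \<and> y \<in> V \<and> {x, y} \<in> E \<and>
     ((\<exists>z\<in>C. {x, z} \<in> E) \<and> (\<exists>z\<in>C. {y, z} \<in> E) \<or>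
      (\<exists>z\<in>U - C. {x, z} \<in> E) \<and> (\<exists>z\<in>U - C. {y, z} \<in> E))}"

text \<open>The list is cut into consecutive disjoint pairs, which act as independent samples from
  \<open>V \<times> V\<close>.\<close>

fun avoids :: "('a \<times> 'a) set \<Rightarrow> 'a list \<Rightarrow> bool" where
  "avoids W (x # y # zs) \<longleftrightarrow> (x, y) \<notin> W \<and> avoids W zs"
| "avoids W _ \<longleftrightarrow> True"

lemma two_colourable_mono:
  "two_colourable E T \<Longrightarrow> E' \<subseteq> E \<Longrightarrow> T' \<subseteq> T \<Longrightarrow> two_colourable E' T'"
  unfolding two_colourable_def by (meson subsetD)

section \<open>Counting lists of sampled vertices\<close>

lemma finite_lists_of [simp]: "finite V \<Longrightarrow> finite (lists_of V k)"
  unfolding lists_of_def by (simp add: finite_lists_length_eq)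

lemma card_lists_of [simp]: "finite V \<Longrightarrow> card (lists_of V k) = card V ^ k"
  unfolding lists_of_def by (simp add: card_lists_length_eq)

text \<open>The left side consists of two terms of the binomial expansion of the right side. With
  \<open>d\<close> a degree and \<open>d + m\<close> the number of vertices, it bounds the
  contribution of one vertex in \<open>sum_card_uncovered\<close>.\<close>

lemma power_add_ge_two_terms:
  fixes d m :: nat
  shows "(u + 1) * (d * m ^ u) + m ^ (u + 1) \<le> (d + m) ^ (u + 1)"
proof (induction u)
  case 0
  then show ?case by simp
next
  case (Suc u)
  have "(Suc u + 1) * (d * m ^ Suc u) + m ^ (Suc u + 1)
      \<le> (d + m) * ((u + 1) * (d * m ^ u) + m ^ (u + 1))"
    by (simp add: algebra_simps)
  also have "\<dots> \<le> (d + m) * (d + m) ^ (u + 1)"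
    using Suc.IH by (rule mult_left_mono) simp
  finally show ?case by simp
qed

text \<open>Double counting: a vertex of degree \<open>d\<close> contributes \<open>d\<close>
  uncovered pairs for exactly those \<open>(card V - d) ^ u\<close> lists that miss its
  neighbourhood. On average a list leaves at most \<open>card V ^ 2 / (u + 1)\<close> pairs
  uncovered.\<close>

lemma sum_card_uncovered:
  assumes "finite V"
  shows "(u + 1) * (\<Sum>us\<in>lists_of V u. card (uncovered E V (set us))) \<le> card V ^ (u + 2)"
proof -
  define N where "N x = {y \<in> V. {x, y} \<in> E}" for x
  have finN: "finite (N x)" "N x \<subseteq> V" for x using assms by (auto simp: N_def)
  have "(\<Sum>us\<in>lists_of V u. card (uncovered E V (set us)))
      = (\<Sum>us\<in>lists_of V u. \<Sum>x\<in>V. if set us \<inter> N x = {} then card (N x) else 0)"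
  proof (rule sum.cong[OF refl])
    fix us assume "us \<in> lists_of V u"
    then have us: "set us \<subseteq> V" by (simp add: lists_of_def)
    have "uncovered E V (set us) = (SIGMA x:V. if set us \<inter> N x = {} then N x else {})"
      using us unfolding uncovered_def N_def by (auto split: if_splits) blast
    moreover have "card (SIGMA x:V. if set us \<inter> N x = {} then N x else {})
        = (\<Sum>x\<in>V. card (if set us \<inter> N x = {} then N x else {}))"
      using assms finN(1) by (intro card_SigmaI) auto
    ultimately have "card (uncovered E V (set us))
        = (\<Sum>x\<in>V. card (if set us \<inter> N x = {} then N x else {}))"
      by simp
    also have "\<dots> = (\<Sum>x\<in>V. if set us \<inter> N x = {} then card (N x) else 0)"
      by (intro sum.cong) auto
    finally show "card (uncovered E V (set us)) = \<dots>" .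
  qed
  also have "\<dots> = (\<Sum>x\<in>V. \<Sum>us\<in>lists_of V u. if set us \<inter> N x = {} then card (N x) else 0)"
    by (rule sum.swap)
  also have "\<dots> = (\<Sum>x\<in>V. card (N x) * (card V - card (N x)) ^ u)"
  proof (rule sum.cong[OF refl])
    fix x
    have "lists_of V u \<inter> {us. set us \<inter> N x = {}} = lists_of (V - N x) u"
      by (auto simp: lists_of_def)
    then show "(\<Sum>us\<in>lists_of V u. if set us \<inter> N x = {} then card (N x) else 0)
        = card (N x) * (card V - card (N x)) ^ u"
      using assms finN by (simp add: sum.If_cases card_Diff_subset)
  qed
  finally have "(u + 1) * (\<Sum>us\<in>lists_of V u. card (uncovered E V (set us)))
      = (\<Sum>x\<in>V. (u + 1) * (card (N x) * (card V - card (N x)) ^ u))"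
    by (simp add: sum_distrib_left)
  also have "\<dots> \<le> (\<Sum>x\<in>V. card V ^ (u + 1))"
  proof (rule sum_mono)
    fix x
    have "card (N x) + (card V - card (N x)) = card V"
      using card_mono[OF assms finN(2)] by simp
    then show "(u + 1) * (card (N x) * (card V - card (N x)) ^ u) \<le> card V ^ (u + 1)"
      using power_add_ge_two_terms[of u "card (N x)" "card V - card (N x)"] by simp
  qed
  also have "\<dots> = card V ^ (u + 2)" by simp
  finally show ?thesis .
qed

lemma card_lists_avoids:
  assumes "finite V" "W \<subseteq> V \<times> V"
  shows "card {ws \<in> lists_of V (2 * t). avoids W ws} = (card V ^ 2 - card W) ^ t"
proof (induction t)
  case 0
  have "{ws \<in> lists_of V 0. avoids W ws} = {[]}" by (auto simp: lists_of_def)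
  then show ?case by simp
next
  case (Suc t)
  let ?A = "\<lambda>t. {ws \<in> lists_of V (2 * t). avoids W ws}"
  have "?A (Suc t) = (\<lambda>((x, y), ws). x # y # ws) ` ((V \<times> V - W) \<times> ?A t)"
  proof (intro equalityI subsetI)
    fix ws assume ws: "ws \<in> ?A (Suc t)"
    then obtain x y zs where "ws = x # y # zs"
      by (auto simp: lists_of_def length_Suc_conv)
    with ws have "ws = (\<lambda>((x, y), ws). x # y # ws) ((x, y), zs)"
      "((x, y), zs) \<in> (V \<times> V - W) \<times> ?A t"
      by (auto simp: lists_of_def)
    then show "ws \<in> (\<lambda>((x, y), ws). x # y # ws) ` ((V \<times> V - W) \<times> ?A t)" by (rule image_eqI)
  qed (use assms in \<open>auto simp: lists_of_def\<close>)
  moreover have "inj_on (\<lambda>((x, y), ws). x # y # ws) ((V \<times> V - W) \<times> ?A t)"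
    by (auto simp: inj_on_def)
  ultimately have "card (?A (Suc t)) = card (V \<times> V - W) * card (?A t)"
    by (simp add: card_image card_cartesian_product)
  also have "card (V \<times> V - W) = card V ^ 2 - card W"
    using assms by (simp add: card_Diff_subset finite_subset card_cartesian_product power2_eq_square)
  finally show ?case using Suc.IH by simp
qed

text \<open>In a proper colouring the ends of a witness would both lie opposite to the common colour
  of their neighbours in \<open>U\<close>, although they are adjacent.\<close>

lemma avoids_witnesses:
  assumes X: "\<And>x y. x \<in> U \<union> set ws \<Longrightarrow> y \<in> U \<union> set ws \<Longrightarrow> {x, y} \<in> E \<Longrightarrow> (x \<in> X) \<noteq> (y \<in> X)"
  shows "avoids (witnesses E V U (U \<inter> X)) ws"
  using X
proof (induction "witnesses E V U (U \<inter> X)" ws rule: avoids.induct)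
  case (1 x y zs)
  have "(x, y) \<notin> witnesses E V U (U \<inter> X)"
    using 1(2) by (auto simp: witnesses_def)
  moreover have "avoids (witnesses E V U (U \<inter> X)) zs"
    by (rule 1(1)) (use 1(2) in auto)
  ultimately show ?case by simp
qed auto

text \<open>The colouring of \<open>U\<close> is extended to all of \<open>V\<close> by putting the
  neighbours of \<open>C\<close> on one side. A monochromatic edge whose ends both have a neighbour
  in \<open>U\<close> is then a witness. The factor 2 arises because an edge can be uncovered at
  either end, while \<open>uncovered\<close> looks at the first coordinate only.\<close>

lemma card_monochromatic_le:
  assumes G: "simple_graph (V, E)" and C: "C \<subseteq> U" "U \<subseteq> V"
  shows "card (monochromatic E {v. \<exists>z\<in>C. {v, z} \<in> E})
    \<le> card (witnesses E V U C) + 2 * card (uncovered E V U)"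
proof -
  let ?X = "{v. \<exists>z\<in>C. {v, z} \<in> E}"
  have V: "finite V" using G by (simp add: simple_graph_def)
  have "witnesses E V U C \<subseteq> V \<times> V" "uncovered E V U \<subseteq> V \<times> V"
    by (auto simp: witnesses_def uncovered_def)
  then have fin: "finite (witnesses E V U C)" "finite (uncovered E V U)"
    using V by (meson finite_SigmaI finite_subset)+
  have "monochromatic E ?X
      \<subseteq> (\<lambda>(x, y). {x, y}) ` (witnesses E V U C \<union> uncovered E V U \<union> prod.swap ` uncovered E V U)"
  proof
    fix e assume e: "e \<in> monochromatic E ?X"
    then have "e \<in> E" by (simp add: monochromatic_def)
    with G obtain x y where xy: "e = {x, y}" "x \<in> V" "y \<in> V" "x \<noteq> y"
      by (auto simp: simple_graph_def card_2_iff)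
    have E: "{x, y} \<in> E" "{y, x} \<in> E" using xy(1) \<open>e \<in> E\<close> by (simp_all add: insert_commute)
    have same: "x \<in> ?X \<longleftrightarrow> y \<in> ?X" using e xy by (auto simp: monochromatic_def)
    show "e \<in> (\<lambda>(x, y). {x, y}) ` (witnesses E V U C \<union> uncovered E V U \<union> prod.swap ` uncovered E V U)"
    proof -
      have "(x, y) \<in> witnesses E V U C \<union> uncovered E V U \<union> prod.swap ` uncovered E V U"
      proof (cases "(x, y) \<in> uncovered E V U \<or> (y, x) \<in> uncovered E V U")
        case True
        then show ?thesis using image_eqI[of "(x, y)" prod.swap "(y, x)"] by auto
      next
        case False
        then obtain z z' where z: "z \<in> U" "{x, z} \<in> E" and z': "z' \<in> U" "{y, z'} \<in> E"
          using xy E by (auto simp: uncovered_def)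
        have "(x, y) \<in> witnesses E V U C"
        proof (cases "x \<in> ?X")
          case True
          then show ?thesis using same xy E unfolding witnesses_def by auto
        next
          case False
          then have "z \<in> U - C" "z' \<in> U - C" using same z z' by auto
          then show ?thesis using xy E z z' unfolding witnesses_def by auto
        qed
        then show ?thesis by simp
      qed
      from imageI[OF this, of "\<lambda>(x, y). {x, y}"] show ?thesis by (simp add: xy(1))
    qed
  qed
  then have "card (monochromatic E ?X)
      \<le> card ((\<lambda>(x, y). {x, y}) ` (witnesses E V U C \<union> uncovered E V U \<union> prod.swap ` uncovered E V U))"
    by (rule card_mono[rotated]) (use fin in simp)
  also have "\<dots> \<le> card (witnesses E V U C \<union> uncovered E V U \<union> prod.swap ` uncovered E V U)"
    using fin by (intro card_image_le) auto
  also have "\<dots> \<le> card (witnesses E V U C) + card (uncovered E V U) + card (prod.swap ` uncovered E V U)"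
    by (meson add_right_mono card_Un_le order_trans)
  also have "\<dots> \<le> card (witnesses E V U C) + 2 * card (uncovered E V U)"
    using card_image_le[OF fin(2), of prod.swap] by simp
  finally show ?thesis .
qed

text \<open>
  The first \<open>u\<close> vertices leave few edges uncovered (Markov's inequality gives the first term).
  Then each of the \<open>2 ^ u\<close> colourings of these vertices has many witnesses, and the remaining
  \<open>t\<close> pairs avoid all of them with probability at most \<open>exp (- \<epsilon> * t / 2)\<close>.
\<close>

lemma card_colourable_lists:
  assumes G: "simple_graph (V, E)" and far: "far_from_bipartite \<epsilon> (V, E)"
    and "V \<noteq> {}" "\<epsilon> > 0"
  shows "real (card {xs \<in> lists_of V (u + 2 * t). two_colourable E (set xs)})
    \<le> (4 / (\<epsilon> * (u + 1)) + 2 ^ u * exp (- (\<epsilon> * t / 2))) * real (card V) ^ (u + 2 * t)"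
proof -
  define n where "n = card V"
  define K where "K = 2 ^ u * exp (- (\<epsilon> * t / 2))"
  have V: "finite V" using G by (simp add: simple_graph_def)
  have n: "n > 0" using V \<open>V \<noteq> {}\<close> by (auto simp: n_def card_gt_0_iff)
  define S where "S us = {ws \<in> lists_of V (2 * t). two_colourable E (set us \<union> set ws)}" for us
  have finS: "finite (S us)" for us using V by (simp add: S_def)
  \<comment> \<open>Markov's inequality in pointwise form: if more than
    \<open>\<epsilon> * n ^ 2 / 4\<close> pairs are uncovered, the last term alone exceeds the
    trivial bound. One formula thus covers both cases and can be summed over
    \<open>us\<close>.\<close>
  have card_S: "real (card (S us)) \<le> real n ^ (2 * t) * (K + 4 / (\<epsilon> * real n ^ 2) * card (uncovered E V (set us)))"
    if us: "us \<in> lists_of V u" for us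
  proof (cases "card (uncovered E V (set us)) \<le> \<epsilon> * real n ^ 2 / 4")
    case False
    have "card (S us) \<le> card (lists_of V (2 * t))"
      using V by (intro card_mono) (auto simp: S_def)
    then have "real (card (S us)) \<le> real n ^ (2 * t) * 1"
      using V by (metis card_lists_of mult.right_neutral n_def of_nat_le_iff of_nat_power)
    also have "\<dots> \<le> real n ^ (2 * t) * (K + 4 / (\<epsilon> * real n ^ 2) * card (uncovered E V (set us)))"
    proof (rule mult_left_mono)
      have "1 \<le> 4 / (\<epsilon> * real n ^ 2) * card (uncovered E V (set us))"
        using False n \<open>\<epsilon> > 0\<close> by (simp add: field_simps)
      moreover have "K \<ge> 0" by (simp add: K_def)
      ultimately show "1 \<le> K + 4 / (\<epsilon> * real n ^ 2) * card (uncovered E V (set us))" by linarith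
    qed simp
    finally show ?thesis .
  next
    case True
    have us': "set us \<subseteq> V" "length us = u" using us by (auto simp: lists_of_def)
    define W where "W C = witnesses E V (set us) C" for C
    define A where "A C = {ws \<in> lists_of V (2 * t). avoids (W C) ws}" for C
    have finA: "finite (A C)" for C using V by (simp add: A_def)
    have card_A: "real (card (A C)) \<le> real n ^ (2 * t) * exp (- (\<epsilon> * t / 2))" if C: "C \<subseteq> set us" for C
    proof -
      have "W C \<subseteq> V \<times> V" by (auto simp: W_def witnesses_def)
      then have cA: "card (A C) = (n ^ 2 - card (W C)) ^ t"
        using card_lists_avoids[OF V] by (simp add: A_def n_def)
      have "card (W C) \<le> card (V \<times> V)" using \<open>W C \<subseteq> V \<times> V\<close> V by (intro card_mono) auto
      then have "card (W C) \<le> n ^ 2" by (simp add: n_def card_cartesian_product power2_eq_square)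
      have "\<epsilon> * real n ^ 2 \<le> real (card (monochromatic E {v. \<exists>z\<in>C. {v, z} \<in> E}))"
        using far by (simp add: far_from_bipartite_def n_def)
      also have "\<dots> \<le> real (card (W C) + 2 * card (uncovered E V (set us)))"
        using card_monochromatic_le[OF G C us'(1)] by (simp only: of_nat_le_iff W_def)
      \<comment> \<open>At most \<open>\<epsilon> * n ^ 2 / 4\<close> uncovered pairs, counted
        twice, leave at least \<open>\<epsilon> * n ^ 2 / 2\<close> witnesses.\<close>
      finally have "real (n ^ 2 - card (W C)) \<le> real n ^ 2 * (1 - \<epsilon> / 2)"
        using True \<open>card (W C) \<le> n ^ 2\<close> by (simp add: of_nat_diff algebra_simps)
      also have "\<dots> \<le> real n ^ 2 * exp (- \<epsilon> / 2)"
        using exp_ge_add_one_self[of "- \<epsilon> / 2"] by (intro mult_left_mono) auto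
      finally have "real (n ^ 2 - card (W C)) ^ t \<le> (real n ^ 2 * exp (- \<epsilon> / 2)) ^ t"
        by (rule power_mono) simp
      also have "\<dots> = real n ^ (2 * t) * exp (- (\<epsilon> * t / 2))"
        by (simp add: power_mult_distrib power_mult flip: exp_of_nat_mult)
      finally show ?thesis by (simp only: cA of_nat_power)
    qed
    have "S us \<subseteq> (\<Union>C\<in>Pow (set us). A C)"
    proof
      fix ws assume ws: "ws \<in> S us"
      then have "two_colourable E (set us \<union> set ws)" by (simp add: S_def)
      then obtain X where X: "\<forall>x\<in>set us \<union> set ws. \<forall>y\<in>set us \<union> set ws.
          {x, y} \<in> E \<longrightarrow> (x \<in> X) \<noteq> (y \<in> X)"
        unfolding two_colourable_def by (elim exE)
      have "avoids (witnesses E V (set us) (set us \<inter> X)) ws"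
        by (rule avoids_witnesses) (rule X[rule_format])
      then have "ws \<in> A (set us \<inter> X)"
        using ws by (simp add: S_def A_def W_def)
      then show "ws \<in> (\<Union>C\<in>Pow (set us). A C)" by auto
    qed
    then have "card (S us) \<le> card (\<Union>C\<in>Pow (set us). A C)"
      using finA by (intro card_mono) auto
    also have "\<dots> \<le> (\<Sum>C\<in>Pow (set us). card (A C))"
      by (rule card_UN_le) simp
    finally have "real (card (S us)) \<le> (\<Sum>C\<in>Pow (set us). real (card (A C)))"
      by (simp only: of_nat_sum [symmetric] of_nat_le_iff)
    also have "\<dots> \<le> (\<Sum>C\<in>Pow (set us). real n ^ (2 * t) * exp (- (\<epsilon> * t / 2)))"
      by (rule sum_mono) (use card_A in auto)
    also have "\<dots> = 2 ^ card (set us) * (real n ^ (2 * t) * exp (- (\<epsilon> * t / 2)))"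
      by (simp add: card_Pow)
    also have "\<dots> \<le> 2 ^ u * (real n ^ (2 * t) * exp (- (\<epsilon> * t / 2)))"
      using card_length[of us] us'(2) by (intro mult_right_mono power_increasing) auto
    also have "\<dots> \<le> real n ^ (2 * t) * (K + 4 / (\<epsilon> * real n ^ 2) * card (uncovered E V (set us)))"
      using \<open>\<epsilon> > 0\<close> by (simp add: K_def algebra_simps)
    finally show ?thesis .
  qed
  let ?S = "{xs \<in> lists_of V (u + 2 * t). two_colourable E (set xs)}"
  have "inj_on (\<lambda>xs. (take u xs, drop u xs)) ?S"
    by (rule inj_on_inverseI[where g = "\<lambda>(us, ws). us @ ws"]) simp
  moreover have "(\<lambda>xs. (take u xs, drop u xs)) ` ?S \<subseteq> (SIGMA us:lists_of V u. S us)"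
  proof (clarsimp, intro conjI)
    fix xs assume xs: "xs \<in> lists_of V (u + 2 * t)" "two_colourable E (set xs)"
    then show "take u xs \<in> lists_of V u"
      using set_take_subset[of u xs] by (auto simp: lists_of_def)
    have "drop u xs \<in> lists_of V (2 * t)"
      using xs set_drop_subset[of u xs] by (auto simp: lists_of_def)
    moreover have "set (take u xs) \<union> set (drop u xs) = set xs"
      by (metis append_take_drop_id set_append)
    ultimately show "drop u xs \<in> S (take u xs)" using xs by (simp add: S_def)
  qed
  ultimately have "card ?S \<le> card (SIGMA us:lists_of V u. S us)"
    using V finS by (intro card_inj_on_le) auto
  also have "\<dots> = (\<Sum>us\<in>lists_of V u. card (S us))"
    using V finS by (intro card_SigmaI) auto
  finally have "real (card ?S) \<le> (\<Sum>us\<in>lists_of V u. real (card (S us)))"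
    by (simp only: of_nat_sum [symmetric] of_nat_le_iff)
  also have "\<dots> \<le> (\<Sum>us\<in>lists_of V u.
      real n ^ (2 * t) * (K + 4 / (\<epsilon> * real n ^ 2) * card (uncovered E V (set us))))"
    by (rule sum_mono) (rule card_S)
  also have "\<dots> = real n ^ (2 * t) * (real n ^ u * K + 4 / (\<epsilon> * real n ^ 2) *
      (\<Sum>us\<in>lists_of V u. real (card (uncovered E V (set us)))))"
    using V by (simp add: sum.distrib sum_distrib_left sum_divide_distrib algebra_simps n_def)
  also have "\<dots> \<le> real n ^ (2 * t) * (real n ^ u * K + 4 / (\<epsilon> * real n ^ 2) * (real n ^ (u + 2) / (u + 1)))"
  proof (intro mult_left_mono add_left_mono)
    have "real ((u + 1) * (\<Sum>us\<in>lists_of V u. card (uncovered E V (set us)))) \<le> real (n ^ (u + 2))"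
      using sum_card_uncovered[OF V] by (simp only: of_nat_le_iff n_def)
    then show "(\<Sum>us\<in>lists_of V u. real (card (uncovered E V (set us)))) \<le> real n ^ (u + 2) / (u + 1)"
      by (simp add: field_simps)
  qed (use \<open>\<epsilon> > 0\<close> in auto)
  also have "\<dots> = (4 / (\<epsilon> * (u + 1)) + K) * real n ^ (u + 2 * t)"
    using n \<open>\<epsilon> > 0\<close> by (simp add: field_simps power_add power2_eq_square)
  finally show ?thesis by (simp add: K_def n_def)
qed

text \<open>The lengths \<open>u\<close> and \<open>t\<close> make each of the two error terms in
  \<open>card_colourable_lists\<close> at most \<open>1 / 12\<close>; the \<open>t\<close> pairs
  need \<open>2 * t\<close> vertices.\<close>

definition sample_size :: "real \<Rightarrow> nat" where
  "sample_size \<epsilon> = (let u = nat \<lceil>48 / \<epsilon>\<rceil> in u + 2 * nat \<lceil>2 * (real u + 3) / \<epsilon>\<rceil>)"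

text \<open>Each ceiling costs at most 1, so \<open>u \<le> 48 / \<epsilon> + 1\<close> and
  \<open>t \<le> 2 * (48 / \<epsilon> + 4) / \<epsilon> + 1\<close>; the coefficients are those of
  \<open>u + 2 * t\<close>.\<close>

lemma sample_size_le:
  assumes "\<epsilon> > 0"
  shows "real (sample_size \<epsilon>) \<le> poly [:3, 64, 192:] (1 / \<epsilon>)"
proof -
  define u where "u = nat \<lceil>48 / \<epsilon>\<rceil>"
  define t where "t = nat \<lceil>2 * (real u + 3) / \<epsilon>\<rceil>"
  have ceil: "real (nat \<lceil>x\<rceil>) \<le> x + 1" if "x \<ge> 0" for x :: real
    using that by linarith
  have u: "real u \<le> 48 / \<epsilon> + 1" using ceil[of "48 / \<epsilon>"] assms by (simp add: u_def)
  have "real t \<le> 2 * (real u + 3) / \<epsilon> + 1"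
    using ceil[of "2 * (real u + 3) / \<epsilon>"] assms by (simp add: t_def)
  also have "\<dots> \<le> 2 * (48 / \<epsilon> + 4) / \<epsilon> + 1"
    using u assms by (intro add_right_mono divide_right_mono) auto
  finally have "real u + 2 * real t \<le> 48 / \<epsilon> + 1 + 2 * (2 * (48 / \<epsilon> + 4) / \<epsilon> + 1)"
    using u by (intro add_mono mult_left_mono) auto
  also have "\<dots> = poly [:3, 64, 192:] (1 / \<epsilon>)"
    by (simp add: algebra_simps add_divide_distrib)
  finally show ?thesis
    by (simp add: sample_size_def Let_def u_def t_def)
qed

text \<open>The bound is \<open>1 / 6\<close> and not \<open>1 / 3\<close> because passing from
  lists to sets loses a factor of 2.\<close>

lemma card_colourable_lists_le:
  assumes "simple_graph (V, E)" "far_from_bipartite \<epsilon> (V, E)" "V \<noteq> {}" "\<epsilon> > 0"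
  shows "real (card {xs \<in> lists_of V (sample_size \<epsilon>). two_colourable E (set xs)})
    \<le> real (card V) ^ sample_size \<epsilon> / 6"
proof -
  define u where "u = nat \<lceil>48 / \<epsilon>\<rceil>"
  define t where "t = nat \<lceil>2 * (real u + 3) / \<epsilon>\<rceil>"
  have "48 / \<epsilon> \<le> real u + 1" unfolding u_def by linarith
  then have 1: "4 / (\<epsilon> * (real u + 1)) \<le> 1 / 12"
    using \<open>\<epsilon> > 0\<close> by (simp add: field_simps)
  have "2 * (real u + 3) / \<epsilon> \<le> real t" unfolding t_def by linarith
  then have "real u + 3 \<le> \<epsilon> * t / 2" using \<open>\<epsilon> > 0\<close> by (simp add: field_simps)
  then have "exp (- (\<epsilon> * t / 2)) \<le> exp (- real u) * exp (- 3)"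
    by (simp flip: exp_add)
  then have "2 ^ u * exp (- (\<epsilon> * t / 2)) \<le> 2 ^ u * (exp (- real u) * exp (- 3))"
    by (rule mult_left_mono) simp
  also have "\<dots> = (2 * exp (- 1)) ^ u * exp (- 3)"
    by (simp add: power_mult_distrib flip: exp_of_nat_mult)
  \<comment> \<open>The choice of \<open>t\<close> beats the \<open>2 ^ u\<close> colourings since
    \<open>2 / e < 1\<close>; the 3 in \<open>u + 3\<close> supplies the constant, as
    \<open>e ^ 3 \<ge> 12\<close>.\<close>
  also have "\<dots> \<le> 1 ^ u * (1 / 12)"
  proof (intro mult_mono power_mono)
    have e: "(5 :: real) / 2 \<le> exp 1"
      using exp_lower_Taylor_quadratic[of 1] by simp
    then show "2 * exp (- 1) \<le> (1 :: real)" by (simp add: exp_minus field_simps)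
    have "(12 :: real) \<le> (5 / 2) ^ 3" by (simp add: power3_eq_cube)
    also have "\<dots> \<le> exp 1 ^ 3" using e by (intro power_mono) auto
    also have "\<dots> = exp 3" by (simp flip: exp_of_nat_mult)
    finally show "exp (- 3) \<le> (1 / 12 :: real)" by (simp add: exp_minus field_simps)
  qed auto
  finally have 2: "2 ^ u * exp (- (\<epsilon> * t / 2)) \<le> 1 / 12" by simp
  have s: "sample_size \<epsilon> = u + 2 * t"
    by (simp add: sample_size_def Let_def u_def t_def)
  have "real (card {xs \<in> lists_of V (u + 2 * t). two_colourable E (set xs)})
      \<le> (4 / (\<epsilon> * (u + 1)) + 2 ^ u * exp (- (\<epsilon> * t / 2))) * real (card V) ^ (u + 2 * t)"
    using card_colourable_lists[OF assms] .
  also have "\<dots> \<le> (1 / 6) * real (card V) ^ (u + 2 * t)"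
    using 1 2 by (intro mult_right_mono) (auto simp: add_ac)
  finally show ?thesis by (simp add: s)
qed

section \<open>From lists with repetition to random vertex sets\<close>

text \<open>The right side counts the lists without repetition. Their share of all lists is at least
  \<open>(1 - w / n) ^ w\<close>, which Bernoulli's inequality bounds below by
  \<open>1 - w ^ 2 / n\<close>.\<close>

lemma power_le_fact_times_binomial:
  assumes "2 * w ^ 2 \<le> n" "n > 0"
  shows "real n ^ w / 2 \<le> fact w * real (n choose w)"
proof -
  have wn: "w \<le> n" 
    using assms by (metis le_add2 le_square le_trans mult_2 power2_eq_square)
  have "real n ^ w / 2 \<le> real n ^ w * (1 + real w * (- (w / n)))"
  proof -
    have "2 * (real w * real w) \<le> real n"
      using assms(1) by (metis of_nat_le_iff of_nat_mult of_nat_numeral power2_eq_square)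
    then have "1 / 2 \<le> 1 + real w * (- (w / n))" using assms(2) by (simp add: field_simps)
    then have "real n ^ w * (1 / 2) \<le> real n ^ w * (1 + real w * (- (w / n)))"
      by (rule mult_left_mono) simp
    then show ?thesis by simp
  qed
  also have "\<dots> \<le> real n ^ w * (1 + (- (w / n))) ^ w"
    using wn assms(2) by (intro mult_left_mono Bernoulli_inequality) (auto simp: field_simps)
  also have "\<dots> = (real n - real w) ^ w"
    using assms(2) by (simp add: algebra_simps flip: power_mult_distrib)
  also have "\<dots> = (\<Prod>i = 0..<w. real n - real w)" by simp
  also have "\<dots> \<le> (\<Prod>i = 0..<w. real n - real i)"
    using wn by (intro prod_mono) auto
  also have "\<dots> = fact w * real (n choose w)"
    by (simp add: binomial_gbinomial gbinomial_mult_fact)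
  finally show ?thesis .
qed

lemma set_pmf_random_vertices:
  assumes "finite (verts G)" "w \<le> card (verts G)"
  shows "set_pmf (random_vertices G w) = {S. S \<subseteq> verts G \<and> card S = w}"
proof -
  have "finite {S. S \<subseteq> verts G \<and> card S = w}" using assms(1) by simp
  moreover have "{S. S \<subseteq> verts G \<and> card S = w} \<noteq> {}"
    using obtain_subset_with_card_n[OF assms(2)] by blast
  ultimately show ?thesis by (simp add: random_vertices_def set_pmf_of_set)
qed

text \<open>All \<open>fact w\<close> orderings of a set in \<open>B\<close> belong to
  \<open>L\<close>, and different sets have different orderings. So \<open>card L\<close> bounds
  \<open>fact w\<close> times the number of bad sets.\<close>

lemma prob_random_vertices_le:
  assumes V: "finite V" "V \<noteq> {}" and n: "2 * w ^ 2 \<le> card V"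
    and L: "\<And>xs. xs \<in> lists_of V w \<Longrightarrow> set xs \<in> B \<Longrightarrow> xs \<in> L"
    and cL: "finite L" "real (card L) \<le> real (card V) ^ w / 6"
  shows "measure_pmf.prob (random_vertices (V, E) w) B \<le> 1 / 3"
proof -
  define n where "n = card V"
  define B' where "B' = {S. S \<subseteq> V \<and> card S = w} \<inter> B"
  have n0: "n > 0" using V by (auto simp: n_def card_gt_0_iff)
  have wn: "w \<le> card V"
    using n by (metis le_add2 le_square le_trans mult_2 power2_eq_square)
  have finB: "finite B'" using V by (simp add: B'_def)
  have "(\<Union>S\<in>B'. permutations_of_set S) \<subseteq> L"
  proof
    fix xs assume "xs \<in> (\<Union>S\<in>B'. permutations_of_set S)"
    then have "set xs \<in> B'" "distinct xs" by (auto simp: permutations_of_set_def)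
    then have "set xs \<in> B" "xs \<in> lists_of V w"
      by (auto simp: B'_def lists_of_def distinct_card)
    then show "xs \<in> L" using L by blast
  qed
  then have "card (\<Union>S\<in>B'. permutations_of_set S) \<le> card L" by (rule card_mono[OF cL(1)])
  moreover have "card (\<Union>S\<in>B'. permutations_of_set S) = (\<Sum>S\<in>B'. card (permutations_of_set S))"
    using finB finite_permutations_of_set by (intro card_UN_disjoint ballI impI) (auto simp: permutations_of_set_def)
  moreover have "(\<Sum>S\<in>B'. card (permutations_of_set S)) = (\<Sum>S\<in>B'. fact w)"
    by (rule sum.cong) (use V in \<open>auto simp: B'_def finite_subset\<close>)
  ultimately have "card B' * fact w \<le> card L" by simp
  then have "real (card B') * fact w \<le> real (card L)"
    by (metis of_nat_fact of_nat_le_iff of_nat_mult)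
  also have "\<dots> \<le> (real n ^ w / 2) / 3" using cL(2) by (simp add: n_def)
  also have "\<dots> \<le> (fact w * real (n choose w)) / 3"
    using power_le_fact_times_binomial[of w n] n n0 by (intro divide_right_mono) (auto simp: n_def)
  finally have "fact w * real (card B') \<le> fact w * (real (n choose w) / 3)" by (simp add: mult.commute)
  then have "real (card B') \<le> real (n choose w) / 3" by (simp add: mult_le_cancel_left)
  moreover have "measure_pmf.prob (random_vertices (V, E) w) B = real (card B') / real (n choose w)"
  proof -
    have "{S. S \<subseteq> V \<and> card S = w} \<noteq> {}"
      using obtain_subset_with_card_n[OF wn] by blast
    then show ?thesis
      using V by (simp add: random_vertices_def measure_pmf_of_set n_subsets B'_def n_def)
  qed
  moreover have "real (n choose w) > 0" using wn by (simp add: n_def)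
  ultimately show ?thesis by (simp only: pos_divide_le_eq)
qed

text \<open>The first \<open>sample_size \<epsilon>\<close> entries of a list already form a good
  sample, whatever follows. The event concerns small subsets of \<open>S\<close> because that is all
  \<open>locally_bipartite\<close> can control; with \<open>w = sample_size \<epsilon>\<close> it
  covers \<open>S\<close> itself.\<close>

lemma prob_locally_colourable_le:
  assumes G: "simple_graph (V, E)" "far_from_bipartite \<epsilon> (V, E)" and "V \<noteq> {}" "\<epsilon> > 0"
    and w: "sample_size \<epsilon> \<le> w" "2 * w ^ 2 \<le> card V"
  shows "measure_pmf.prob (random_vertices (V, E) w)
      {S. \<forall>T\<subseteq>S. card T \<le> sample_size \<epsilon> \<longrightarrow> two_colourable E T} \<le> 1 / 3"
proof (rule prob_random_vertices_le)
  define q where "q = sample_size \<epsilon>"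
  let ?L = "{xs \<in> lists_of V w. two_colourable E (set (take q xs))}"
  let ?Q = "{xs \<in> lists_of V q. two_colourable E (set xs)}"
  show V: "finite V" using G by (simp add: simple_graph_def)
  show "finite ?L" using V by simp
  show "xs \<in> ?L" if "xs \<in> lists_of V w"
    and S: "set xs \<in> {S. \<forall>T\<subseteq>S. card T \<le> sample_size \<epsilon> \<longrightarrow> two_colourable E T}" for xs
  proof -
    have "set (take q xs) \<subseteq> set xs" by (rule set_take_subset)
    moreover have "card (set (take q xs)) \<le> sample_size \<epsilon>"
      using card_length[of "take q xs"] by (simp add: q_def)
    ultimately show ?thesis using that by simp
  qed
  have "inj_on (\<lambda>xs. (take q xs, drop q xs)) ?L"
    by (rule inj_on_inverseI[where g = "\<lambda>(us, ws). us @ ws"]) simp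
  moreover have "(\<lambda>xs. (take q xs, drop q xs)) ` ?L \<subseteq> ?Q \<times> lists_of V (w - q)"
    using w(1) by (auto simp: lists_of_def q_def dest: in_set_takeD in_set_dropD)
  ultimately have "card ?L \<le> card (?Q \<times> lists_of V (w - q))"
    using V by (intro card_inj_on_le) auto
  also have "\<dots> = card ?Q * card V ^ (w - q)" using V by (simp add: card_cartesian_product)
  finally have "real (card ?L) \<le> real (card ?Q) * real (card V) ^ (w - q)"
    by (simp only: of_nat_le_iff flip: of_nat_power of_nat_mult)
  also have "\<dots> \<le> (real (card V) ^ q / 6) * real (card V) ^ (w - q)"
    using card_colourable_lists_le[OF assms(1-4)] by (intro mult_right_mono) (auto simp: q_def)
  also have "\<dots> = real (card V) ^ w / 6"
    using w(1) by (simp add: q_def flip: power_add)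
  finally show "real (card ?L) \<le> real (card V) ^ w / 6" .
qed (use assms in auto)

section \<open>Locally bipartite graphs\<close>

text \<open>The bound on \<open>T\<close> depends on the order of the graph, so the property
  inspects a small induced subgraph only on very small sets. This is what makes one-sided testing
  expensive.\<close>

definition locally_bipartite :: "(nat \<Rightarrow> nat) \<Rightarrow> ugraph \<Rightarrow> bool" where
  "locally_bipartite h G \<longleftrightarrow>
     (\<forall>T\<subseteq>verts G. card T \<le> h (card (verts G)) \<longrightarrow> two_colourable (edges G) T)"

lemma two_colourable_induced:
  "T \<subseteq> S \<Longrightarrow> two_colourable (edges (induced G S)) T \<longleftrightarrow> two_colourable (edges G) T"
  unfolding two_colourable_def by (simp add: induced_def subset_iff cong: ball_cong)

lemma two_colourable_isomorphic:
  assumes G: "simple_graph G" and h: "inj_on h (verts G)" and T: "T \<subseteq> verts G"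
    and c: "two_colourable (edges G) T"
  shows "two_colourable ((\<lambda>e. h ` e) ` edges G) (h ` T)"
proof -
  obtain X where X: "\<forall>x\<in>T. \<forall>y\<in>T. {x, y} \<in> edges G \<longrightarrow> (x \<in> X) \<noteq> (y \<in> X)"
    using c unfolding two_colourable_def by (elim exE)
  \<comment> \<open>The colour class is cut down to \<open>T\<close> before it is mapped, since
    \<open>h\<close> is injective only on \<open>verts G\<close>.\<close>
  show ?thesis
    unfolding two_colourable_def
  proof (intro exI[of _ "h ` (X \<inter> T)"] ballI impI)
    fix x' y' assume "x' \<in> h ` T" "y' \<in> h ` T" and e: "{x', y'} \<in> (\<lambda>e. h ` e) ` edges G"
    then obtain x y where xy: "x \<in> T" "y \<in> T" "x' = h x" "y' = h y" by auto
    from e obtain e where "e \<in> edges G" "h ` {x, y} = h ` e" by (auto simp: xy)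
    moreover have "e \<subseteq> verts G" using G \<open>e \<in> edges G\<close> by (simp add: simple_graph_def)
    ultimately have "{x, y} \<in> edges G"
      using inj_on_image_eq_iff[OF h, of "{x, y}" e] xy T by auto
    then have "(x \<in> X) \<noteq> (y \<in> X)" using X xy by simp
    moreover have "h z \<in> h ` (X \<inter> T) \<longleftrightarrow> z \<in> X" if "z \<in> T" for z
      using inj_on_image_mem_iff[OF h, of z "X \<inter> T"] that T by blast
    ultimately show "(x' \<in> h ` (X \<inter> T)) \<noteq> (y' \<in> h ` (X \<inter> T))" using xy by simp
  qed
qed

text \<open>Monotonicity of \<open>h\<close> serves vertex removal: the smaller graph is inspected
  on sets that are no larger.\<close>

lemma monotone_locally_bipartite:
  assumes "mono h"
  shows "monotone_graph_property (locally_bipartite h)"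
  unfolding monotone_graph_property_def graph_property_def
proof (intro conjI allI impI)
  fix G H assume G: "simple_graph G" and P: "locally_bipartite h G" and "isomorphic_graphs G H"
  then obtain g where g: "bij_betw g (verts G) (verts H)" and H: "edges H = (\<lambda>e. g ` e) ` edges G"
    by (auto simp: isomorphic_graphs_def)
  have inj: "inj_on g (verts G)" using g by (rule bij_betw_imp_inj_on)
  show "locally_bipartite h H"
    unfolding locally_bipartite_def
  proof (intro allI impI)
    fix T assume T: "T \<subseteq> verts H" "card T \<le> h (card (verts H))"
    then obtain T' where T': "T' \<subseteq> verts G" "T = g ` T'"
      using g by (metis bij_betw_imp_surj_on subset_imageE)
    have "card T' = card T" using T' inj by (metis card_image inj_on_subset)
    then have "two_colourable (edges G) T'"
      using P T T' bij_betw_same_card[OF g] by (simp add: locally_bipartite_def)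
    then show "two_colourable (edges H) T"
      using two_colourable_isomorphic[OF G inj T'(1)] by (simp add: H T'(2))
  qed
next
  fix G S assume G: "simple_graph G" and P: "locally_bipartite h G" and S: "S \<subseteq> verts G"
  have "card S \<le> card (verts G)"
    using G S by (intro card_mono) (auto simp: simple_graph_def)
  then have "h (card S) \<le> h (card (verts G))" by (rule monoD[OF assms])
  then show "locally_bipartite h (induced G S)"
    using P S two_colourable_induced[of _ S G]
    by (simp add: locally_bipartite_def induced_def subset_trans)
next
  fix G F assume "locally_bipartite h G"
  moreover have "two_colourable (edges G - F) T" if "two_colourable (edges G) T" for T
    using that Diff_subset subset_refl by (rule two_colourable_mono)
  ultimately show "locally_bipartite h (remove_edges G F)"
    by (simp add: locally_bipartite_def remove_edges_def)
qed

section \<open>Distance to the property versus distance to bipartiteness\<close>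

text \<open>Deleting the monochromatic edges of \<open>X\<close> leaves a graph properly coloured by
  \<open>X\<close>, which has the property for every \<open>h\<close>.\<close>

lemma eps_far_imp_far_from_bipartite:
  assumes "eps_far (locally_bipartite h) \<epsilon> G"
  shows "far_from_bipartite \<epsilon> G"
  unfolding far_from_bipartite_def
proof
  fix X
  have "two_colourable (edges G - monochromatic (edges G) X) T" for T
    unfolding two_colourable_def by (intro exI[of _ X]) (simp add: monochromatic_def, meson)
  then have "locally_bipartite h (remove_edges G (monochromatic (edges G) X))"
    by (simp add: locally_bipartite_def remove_edges_def)
  then show "\<epsilon> * real (card (verts G)) ^ 2 \<le> real (card (monochromatic (edges G) X))"
    using assms by (auto simp: eps_far_def monochromatic_def)
qed

text \<open>Probabilistic method: random samples show that a large graph far from bipartite contains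
  a non-bipartite subgraph on at most \<open>sample_size \<epsilon>\<close> vertices.\<close>

lemma not_locally_bipartite:
  assumes G: "simple_graph G" "far_from_bipartite \<epsilon> G" and "verts G \<noteq> {}" "\<epsilon> > 0"
    and n: "2 * sample_size \<epsilon> ^ 2 \<le> card (verts G)" "sample_size \<epsilon> \<le> h (card (verts G))"
  shows "\<not> locally_bipartite h G"
proof
  assume P: "locally_bipartite h G"
  let ?q = "sample_size \<epsilon>"
  have q: "?q \<le> card (verts G)"
    using n(1) by (metis le_add2 le_square le_trans mult_2 power2_eq_square)
  have fin: "finite (verts G)" using G by (simp add: simple_graph_def)
  have "measure_pmf.prob (random_vertices G ?q)
      {S. \<forall>T\<subseteq>S. card T \<le> ?q \<longrightarrow> two_colourable (edges G) T} = 1"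
    using P set_pmf_random_vertices[OF fin q] n(2)
    by (subst measure_pmf.prob_eq_1) (auto simp: AE_measure_pmf_iff locally_bipartite_def)
  moreover have "measure_pmf.prob (random_vertices G ?q)
      {S. \<forall>T\<subseteq>S. card T \<le> ?q \<longrightarrow> two_colourable (edges G) T} \<le> 1 / 3"
    using prob_locally_colourable_le[of "verts G" "edges G" \<epsilon> ?q] assms by simp
  ultimately show False by simp
qed

text \<open>An approximate converse of \<open>eps_far_imp_far_from_bipartite\<close>: after fewer
  than \<open>\<epsilon> * n ^ 2\<close> deletions the graph is still
  \<open>(c - \<epsilon>)\<close>-far from bipartite, so \<open>not_locally_bipartite\<close>
  applies.\<close>

lemma eps_far_locally_bipartite:
  assumes G: "simple_graph G" "far_from_bipartite c G" and "verts G \<noteq> {}" "\<epsilon> < c"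
    and n: "2 * sample_size (c - \<epsilon>) ^ 2 \<le> card (verts G)" "sample_size (c - \<epsilon>) \<le> h (card (verts G))"
  shows "eps_far (locally_bipartite h) \<epsilon> G"
  unfolding eps_far_def
proof (intro allI impI, rule ccontr)
  fix F assume F: "F \<subseteq> edges G" and P: "locally_bipartite h (remove_edges G F)"
    and small: "\<not> \<epsilon> * real (card (verts G)) ^ 2 \<le> real (card F)"
  have "finite (verts G)" "edges G \<subseteq> Pow (verts G)" using G by (auto simp: simple_graph_def)
  then have finE: "finite (edges G)" by (meson finite_Pow_iff finite_subset)
  have "far_from_bipartite (c - \<epsilon>) (remove_edges G F)"
    unfolding far_from_bipartite_def
  proof
    fix X
    have fin: "finite F" "finite (monochromatic (edges G - F) X)"
      using F finE by (auto simp: monochromatic_def intro: finite_subset)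
    have "monochromatic (edges G) X \<subseteq> monochromatic (edges G - F) X \<union> F"
      by (auto simp: monochromatic_def)
    then have "card (monochromatic (edges G) X) \<le> card (monochromatic (edges G - F) X \<union> F)"
      using fin by (intro card_mono) auto
    also have "\<dots> \<le> card (monochromatic (edges G - F) X) + card F" by (rule card_Un_le)
    finally have "real (card (monochromatic (edges G) X))
        \<le> real (card (monochromatic (edges G - F) X)) + real (card F)" by simp
    moreover have "c * real (card (verts G)) ^ 2 \<le> real (card (monochromatic (edges G) X))"
      using G by (simp add: far_from_bipartite_def)
    ultimately show "(c - \<epsilon>) * real (card (verts (remove_edges G F))) ^ 2
        \<le> real (card (monochromatic (edges (remove_edges G F)) X))"
      using small by (simp add: remove_edges_def algebra_simps)
  qed
  moreover have "simple_graph (remove_edges G F)"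
    using G by (auto simp: simple_graph_def remove_edges_def)
  ultimately have "\<not> locally_bipartite h (remove_edges G F)"
    using assms by (intro not_locally_bipartite) (auto simp: remove_edges_def)
  then show False using P by simp
qed

section \<open>Upper bounds on both sample complexities\<close>

text \<open>The tester asks whether the sample is bipartite, not whether it has the property. Since
  \<open>sample_size \<epsilon> \<le> h n\<close>, the sampled set is among those that the property
  of \<open>G\<close> controls, so graphs with the property are always accepted.\<close>

lemma two_sided_complexity_le:
  assumes "mono h" "\<epsilon> > 0" "n > 0"
    and n: "2 * sample_size \<epsilon> ^ 2 \<le> n" "sample_size \<epsilon> \<le> h n"
  shows "two_sided_complexity (locally_bipartite h) \<epsilon> n \<le> sample_size \<epsilon>"
proof -
  let ?q = "sample_size \<epsilon>"
  define D where "D H = return_pmf (two_colourable (edges H) (verts H))" for H :: ugraph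
  have q: "?q \<le> n"
    using n(1) by (metis le_add2 le_square le_trans mult_2 power2_eq_square)
  have out: "output_prob D G ?q b = measure_pmf.prob (random_vertices G ?q)
      {S. two_colourable (edges G) S = b}" for G b
  proof -
    have D: "D (induced G S) = return_pmf (two_colourable (edges G) S)" for S
      using two_colourable_induced[of S S G] by (simp add: D_def induced_def)
    show ?thesis
      by (simp add: output_prob_def D pmf_map vimage_def flip: map_pmf_def)
  qed
  have "eps_tester (locally_bipartite h) \<epsilon> n ?q D"
    unfolding eps_tester_def
  proof (intro conjI allI impI)
    fix G assume G: "simple_graph G" "card (verts G) = n" and P: "locally_bipartite h G"
    have fin: "finite (verts G)" using G by (simp add: simple_graph_def)
    have "measure_pmf.prob (random_vertices G ?q) {S. two_colourable (edges G) S = True} = 1"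
      using P set_pmf_random_vertices[OF fin, of ?q] q G(2) n(2)
      by (subst measure_pmf.prob_eq_1) (auto simp: AE_measure_pmf_iff locally_bipartite_def)
    then show "output_prob D G ?q True \<ge> 2 / 3" by (simp add: out)
  next
    fix G assume G: "simple_graph G" "card (verts G) = n" and far: "eps_far (locally_bipartite h) \<epsilon> G"
    let ?M = "random_vertices G ?q"
    have "measure_pmf.prob ?M {S. two_colourable (edges G) S}
        \<le> measure_pmf.prob ?M {S. \<forall>T\<subseteq>S. card T \<le> ?q \<longrightarrow> two_colourable (edges G) T}"
      by (intro measure_pmf.finite_measure_mono)
         (auto intro: two_colourable_mono[OF _ subset_refl])
    also have "\<dots> \<le> 1 / 3"
      using prob_locally_colourable_le[of "verts G" "edges G" \<epsilon> ?q]
        eps_far_imp_far_from_bipartite[OF far] G assms by force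
    finally have "measure_pmf.prob ?M (- {S. two_colourable (edges G) S}) \<ge> 2 / 3"
      by (simp add: measure_pmf.prob_compl[simplified] Compl_eq_Diff_UNIV)
    then show "output_prob D G ?q False \<ge> 2 / 3"
      by (simp add: out Collect_neg_eq)
  qed (use q in simp)
  then show ?thesis unfolding two_sided_complexity_def by (intro Least_le) blast
qed

text \<open>Once \<open>h w\<close> reaches \<open>sample_size \<epsilon>\<close>, a sample with the
  property has only bipartite subsets of that size, which is unlikely. This shows that the one-sided
  complexity is finite.\<close>

lemma one_sided_sample_locally_bipartite:
  assumes "\<epsilon> > 0" "w > 0" and w: "sample_size \<epsilon> \<le> w" "sample_size \<epsilon> \<le> h w"
  shows "one_sided_sample (locally_bipartite h) \<epsilon> w"
  unfolding one_sided_sample_def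
proof (intro exI[of _ "2 * w ^ 2"] conjI allI impI)
  show "w \<le> 2 * w ^ 2" by (metis le_add2 le_square le_trans mult_2 power2_eq_square)
  fix G assume G: "simple_graph G" and n: "2 * w ^ 2 \<le> card (verts G)"
    and far: "eps_far (locally_bipartite h) \<epsilon> G"
  let ?M = "random_vertices G w"
  let ?B = "{S. \<forall>T\<subseteq>S. card T \<le> sample_size \<epsilon> \<longrightarrow> two_colourable (edges G) T}"
  have fin: "finite (verts G)" using G by (simp add: simple_graph_def)
  have wn: "w \<le> card (verts G)" using \<open>w \<le> 2 * w ^ 2\<close> n by simp
  have "measure_pmf.prob ?M {S. locally_bipartite h (induced G S)} \<le> measure_pmf.prob ?M ?B"
  proof (rule measure_pmf.finite_measure_mono_AE)
    have "S \<in> ?B" if S: "card S = w" "locally_bipartite h (induced G S)" for S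
    proof clarify
      fix T assume T: "T \<subseteq> S" "card T \<le> sample_size \<epsilon>"
      then have "two_colourable (edges (induced G S)) T"
        using S w by (simp add: locally_bipartite_def induced_def)
      then show "two_colourable (edges G) T" by (simp add: two_colourable_induced[OF T(1)])
    qed
    then show "AE S in ?M. S \<in> {S. locally_bipartite h (induced G S)} \<longrightarrow> S \<in> ?B"
      using set_pmf_random_vertices[OF fin wn] unfolding AE_measure_pmf_iff by blast
  qed simp
  also have "\<dots> \<le> 1 / 3"
    using prob_locally_colourable_le[of "verts G" "edges G" \<epsilon> w]
      eps_far_imp_far_from_bipartite[OF far] G assms n wn by force
  finally have "measure_pmf.prob ?M (- {S. locally_bipartite h (induced G S)}) \<ge> 2 / 3"
    by (simp add: measure_pmf.prob_compl[simplified] Compl_eq_Diff_UNIV)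
  then show "measure_pmf.prob ?M {S. \<not> locally_bipartite h (induced G S)} \<ge> 2 / 3"
    by (simp add: Collect_neg_eq)
qed

section \<open>Locally bipartite graphs far from bipartite\<close>

text \<open>Every cut leaves at least \<open>n ^ 2 / 4 - n / 2\<close> edges monochromatic. This
  handles distances up to \<open>1 / 4\<close>, whereas triangle blow-ups are only known here to be
  \<open>1 / 9\<close>-far.\<close>

lemma far_complete_graph:
  assumes "\<epsilon> < 1 / 4"
  shows "\<exists>n\<ge>N. far_from_bipartite \<epsilon> ({..<n}, {e. e \<subseteq> {..<n} \<and> card e = 2})"
proof -
  define n where "n = max N (nat \<lceil>2 / (1 - 4 * \<epsilon>)\<rceil>)"
  have "2 / (1 - 4 * \<epsilon>) \<le> real n" unfolding n_def by linarith
  then have n: "2 \<le> real n * (1 - 4 * \<epsilon>)" using assms by (simp add: field_simps)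
  have choose: "real (k choose 2) = (real k ^ 2 - real k) / 2" for k :: nat
    by (cases k) (simp_all add: choose_two real_of_nat_div power2_eq_square field_simps)
  have "far_from_bipartite \<epsilon> ({..<n}, {e. e \<subseteq> {..<n} \<and> card e = 2})"
    unfolding far_from_bipartite_def
  proof
    fix X
    define A where "A = {..<n} \<inter> X"
    define B where "B = {..<n} - X"
    have fin: "finite A" "finite B" by (auto simp: A_def B_def)
    have "card A + card B = card (A \<union> B)"
      using fin by (intro card_Un_disjoint [symmetric]) (auto simp: A_def B_def)
    also have "A \<union> B = {..<n}" by (auto simp: A_def B_def)
    finally have AB: "real n = real (card A) + real (card B)" by simp
    have "monochromatic {e. e \<subseteq> {..<n} \<and> card e = 2} X
        = {e. e \<subseteq> A \<and> card e = 2} \<union> {e. e \<subseteq> B \<and> card e = 2}"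
      by (auto simp: monochromatic_def A_def B_def)
    moreover have "{e. e \<subseteq> A \<and> card e = 2} \<inter> {e. e \<subseteq> B \<and> card e = 2} = {}"
      by (auto simp: A_def B_def card_2_iff)
    ultimately have "card (monochromatic {e. e \<subseteq> {..<n} \<and> card e = 2} X)
        = (card A choose 2) + (card B choose 2)"
      using fin by (simp add: card_Un_disjoint n_subsets)
    then have "real (card (monochromatic {e. e \<subseteq> {..<n} \<and> card e = 2} X))
        = (real (card A) ^ 2 + real (card B) ^ 2 - real n) / 2"
      by (simp add: choose AB field_simps)
    moreover have "real n ^ 2 / 2 \<le> real (card A) ^ 2 + real (card B) ^ 2"
      using zero_le_power2[of "real (card A) - real (card B)"]
      by (simp add: AB power2_eq_square field_simps)
    moreover have "real n * 2 \<le> real n * (real n * (1 - 4 * \<epsilon>))"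
      using n by (rule mult_left_mono) simp
    ultimately show "\<epsilon> * real (card (verts ({..<n}, {e. e \<subseteq> {..<n} \<and> card e = 2}))) ^ 2
        \<le> real (card (monochromatic (edges ({..<n}, {e. e \<subseteq> {..<n} \<and> card e = 2})) X))"
      by (simp add: power2_eq_square algebra_simps)
  qed
  moreover have "n \<ge> N" by (simp add: n_def)
  ultimately show ?thesis by blast
qed

section \<open>Blow-ups of odd cycles\<close>

text \<open>Vertex \<open>x\<close> has position \<open>x div L\<close> in class
  \<open>x mod L\<close>; cyclically consecutive classes, of size \<open>m\<close> each, are
  completely joined.\<close>

definition cycle_blowup :: "nat \<Rightarrow> nat \<Rightarrow> ugraph" where
  "cycle_blowup L m = ({..<L * m},
     {{x, y} |x y. x < L * m \<and> y < L * m \<and> y mod L = Suc x mod L})"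

lemma Suc_mod_neq:
  fixes x :: nat
  assumes "L \<ge> 2"
  shows "Suc x mod L \<noteq> x mod L"
  using assms by (simp add: mod_Suc)

lemma simple_cycle_blowup:
  assumes "L \<ge> 2"
  shows "simple_graph (cycle_blowup L m)"
proof -
  have "card {x, y} = 2" if "y mod L = Suc x mod L" for x y
  proof -
    have "x \<noteq> y" using that Suc_mod_neq[OF assms, of x] by metis
    then show ?thesis by simp
  qed
  then show ?thesis
    unfolding simple_graph_def cycle_blowup_def by auto
qed

text \<open>Fewer than \<open>L\<close> vertices miss some class \<open>r\<close>. Cutting the cycle
  there leaves a path of classes, coloured by parity.\<close>

lemma two_colourable_cycle_blowup:
  assumes "finite T" "card T < L"
  shows "two_colourable (edges (cycle_blowup L m)) T"
proof -
  have L: "L > 0" using assms by simp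
  have "card ((\<lambda>x. x mod L) ` T) < card {..<L}"
    using card_image_le[OF assms(1), of "\<lambda>x. x mod L"] assms(2) by simp
  then have "\<not> {..<L} \<subseteq> (\<lambda>x. x mod L) ` T"
    using card_mono[of "(\<lambda>x. x mod L) ` T" "{..<L}"] assms(1) by auto
  then obtain r where r: "r < L" "\<And>x. x \<in> T \<Longrightarrow> x mod L \<noteq> r" by auto
  \<comment> \<open>Numbers the classes along the path: \<open>r + 1\<close> gets 0 and the missing
    class \<open>r\<close> gets \<open>L - 1\<close>, so no edge inside \<open>T\<close> wraps
    around.\<close>
  define g where "g x = (x + (L - 1 - r)) mod L" for x
  have step: "g y = Suc (g x)" if "x \<in> T" "y mod L = Suc x mod L" for x y
  proof -
    have "g y = (Suc x + (L - 1 - r)) mod L"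
      unfolding g_def by (rule mod_add_cong[OF that(2) refl])
    also have "\<dots> = Suc (x + (L - 1 - r)) mod L" by simp
    also have "\<dots> = Suc (g x)"
    proof -
      have "Suc (g x) \<noteq> L"
      proof
        assume "Suc (g x) = L"
        then have "(Suc (x + (L - 1 - r))) mod L = 0" by (simp add: g_def mod_Suc)
        then have "(Suc (x + (L - 1 - r)) + r) mod L = r mod L"
          using mod_add_cong[of "Suc (x + (L - 1 - r))" L 0 r r] by simp
        moreover have "Suc (x + (L - 1 - r)) + r = x + L" using r(1) by simp
        ultimately have "x mod L = r" using r(1) by simp
        then show False using r(2) that(1) by blast
      qed
      then show ?thesis by (simp add: g_def mod_Suc)
    qed
    finally show ?thesis .
  qed
  show ?thesis
    unfolding two_colourable_def
  proof (intro exI[of _ "{x. even (g x)}"] ballI impI)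
    fix x y assume xy: "x \<in> T" "y \<in> T" "{x, y} \<in> edges (cycle_blowup L m)"
    then have "y mod L = Suc x mod L \<or> x mod L = Suc y mod L"
      by (auto simp: cycle_blowup_def doubleton_eq_iff)
    then have "g y = Suc (g x) \<or> g x = Suc (g y)" using step[OF xy(1)] step[OF xy(2)] by metis
    then show "(x \<in> {x. even (g x)}) \<noteq> (y \<in> {x. even (g x)})" by (elim disjE) simp_all
  qed
qed

text \<open>Otherwise \<open>P\<close> would alternate, agree at 0 and the even number
  \<open>L - 1\<close>, and contradict the closing edge.\<close>

lemma odd_cycle_monochromatic:
  assumes "odd L"
  shows "\<exists>i<L. P (Suc i mod L) \<longleftrightarrow> P i"
proof (rule ccontr)
  assume "\<not> ?thesis"
  then have no: "P (Suc i mod L) \<longleftrightarrow> \<not> P i" if "i < L" for i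
    using that by metis
  have alternate: "i < L \<Longrightarrow> P i \<longleftrightarrow> (P 0 \<longleftrightarrow> even i)" for i
  proof (induction i)
    case (Suc i)
    then have "Suc i mod L = Suc i" "P i \<longleftrightarrow> (P 0 \<longleftrightarrow> even i)" by simp_all
    then show ?case using no[of i] Suc.prems by simp
  qed simp
  have "L > 0" using assms by (rule odd_pos)
  then have "P 0 \<longleftrightarrow> \<not> P (L - 1)" using no[of "L - 1"] by simp
  moreover have "P (L - 1) \<longleftrightarrow> P 0" using alternate[of "L - 1"] assms \<open>L > 0\<close> by simp
  ultimately show False by simp
qed

text \<open>Subtraction modulo \<open>m\<close>; adding \<open>m\<close> first keeps the difference
  of naturals from being truncated.\<close>

lemma add_mod_diff_self:
  fixes a b m :: nat
  assumes "a < m" "b < m"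
  shows "((a + b) mod m + m - a) mod m = b"
proof (cases "a + b < m")
  case True
  then have "(a + b) mod m + m - a = b + m" by simp
  then show ?thesis using assms by simp
next
  case False
  then have "(a + b) mod m = a + b - m"
    using assms by (metis add_less_mono le_mod_geq less_diff_conv2 mod_less not_less)
  then have "(a + b) mod m + m - a = b" using False by simp
  then show ?thesis using assms by simp
qed

text \<open>
  The cycles through the blow-up classes at positions \<open>a, b, a, b, \<dots>, a, b, a + b\<close> (modulo
  \<open>m\<close>) are edge-disjoint: any two consecutive positions determine \<open>a\<close> and \<open>b\<close>.
\<close>

lemma far_cycle_blowup:
  assumes L: "odd L" "L \<ge> 3"
  shows "far_from_bipartite (1 / real L ^ 2) (cycle_blowup L m)"
  unfolding far_from_bipartite_def
proof
  fix X
  define mono_pairs where "mono_pairs = {(x, y). x < L * m \<and> y < L * m \<and> y mod L = Suc x mod L \<and> (x \<in> X \<longleftrightarrow> y \<in> X)}"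
  define pos where "pos a b i = (if i = L - 1 then (a + b) mod m else if even i then a else b)" for a b i
  define v where "v a b i = pos a b i * L + i" for a b i
  \<comment> \<open>Recovers \<open>(a, b)\<close> from one edge of its cycle. The closing edge has
    positions \<open>a + b, a\<close>, the edge before it has \<open>b, a + b\<close>, and on the
    others the parity of the class tells \<open>a\<close> from \<open>b\<close>.\<close>
  define decode where "decode = (\<lambda>(x, y). let p = x div L; q = y div L in
    if x mod L = L - 1 then (q, (p + m - q) mod m)
    else if x mod L = L - 2 then ((q + m - p) mod m, p)
    else if even (x mod L) then (p, q) else (q, p))"
  have sub: "((a + b) mod m + m - a) mod m = b" "((a + b) mod m + m - b) mod m = a"
    if "a < m" "b < m" for a b
    using that add_mod_diff_self[of a m b] add_mod_diff_self[of b m a] by (simp_all add: add.commute)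
  \<comment> \<open>Each of the \<open>m ^ 2\<close> odd cycles has a monochromatic edge, and that
    edge decodes to its own cycle.\<close>
  have "{..<m} \<times> {..<m} \<subseteq> decode ` mono_pairs"
  proof clarify
    fix a b assume ab: "a < m" "b < m"
    obtain i where i: "i < L" "v a b (Suc i mod L) \<in> X \<longleftrightarrow> v a b i \<in> X"
      using odd_cycle_monochromatic[OF L(1), of "\<lambda>i. v a b i \<in> X"] by blast
    have pos: "pos a b j < m" for j using ab by (simp add: pos_def)
    have vm: "v a b j < L * m" if "j < L" for j
    proof -
      have "v a b j < Suc (pos a b j) * L" using that by (simp add: v_def)
      also have "\<dots> \<le> m * L" using pos[of j] by (intro mult_right_mono) auto
      finally show ?thesis by (simp add: mult.commute)
    qed
    have v: "v a b j mod L = j" "v a b j div L = pos a b j" if "j < L" for j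
      using that by (simp_all add: v_def)
    have i': "Suc i mod L < L" using i(1) by simp
    have "Suc (v a b i) mod L = Suc i mod L" using mod_Suc_eq[of "v a b i" L] v(1)[OF i(1)] by simp
    then have "(v a b i, v a b (Suc i mod L)) \<in> mono_pairs"
      using i vm[OF i(1)] vm[OF i'] v(1)[OF i'] by (auto simp: mono_pairs_def)
    moreover have "decode (v a b i, v a b (Suc i mod L)) = (a, b)"
    proof -
      consider "i = L - 1" | "i = L - 2" | "i < L - 2" using i(1) by linarith
      then show ?thesis
      proof cases
        case 1
        then have "Suc i mod L = 0" using L by simp
        then show ?thesis using 1 L v[OF i(1)] v[OF i'] sub[OF ab]
          by (simp add: decode_def Let_def pos_def)
      next
        case 2
        then have "Suc i mod L = L - 1" "odd i" "i \<noteq> L - 1" using L by auto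
        then show ?thesis using 2 L v[OF i(1)] v[OF i'] sub[OF ab]
          by (simp add: decode_def Let_def pos_def)
      next
        case 3
        then have "Suc i mod L = Suc i" "i \<noteq> L - 1" "i \<noteq> L - 2" "Suc i \<noteq> L - 1" using L by auto
        then show ?thesis using L v[OF i(1)] v[OF i']
          by (simp add: decode_def Let_def pos_def)
      qed
    qed
    ultimately show "(a, b) \<in> decode ` mono_pairs" by (intro image_eqI) simp_all
  qed
  moreover have "mono_pairs \<subseteq> {..<L * m} \<times> {..<L * m}" by (auto simp: mono_pairs_def)
  then have fin_pairs: "finite mono_pairs" by (rule finite_subset) simp
  ultimately have "card ({..<m} \<times> {..<m}) \<le> card (decode ` mono_pairs)" by (intro card_mono) auto
  also have "\<dots> \<le> card mono_pairs" by (rule card_image_le[OF fin_pairs])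
  also have "\<dots> \<le> card (monochromatic (edges (cycle_blowup L m)) X)"
  proof (rule card_inj_on_le)
    show "inj_on (\<lambda>(x, y). {x, y}) mono_pairs"
    proof (rule inj_onI, clarify)
      fix x y x' y' assume *: "(x, y) \<in> mono_pairs" "(x', y') \<in> mono_pairs" "{x, y} = {x', y'}"
      \<comment> \<open>No edge is counted in both directions: that would make \<open>L\<close>
        divide 2.\<close>
      have "\<not> (x' = y \<and> y' = x)"
      proof
        assume "x' = y \<and> y' = x"
        then have "y mod L = Suc x mod L" "x mod L = Suc y mod L" using *(1,2) by (simp_all add: mono_pairs_def)
        then have "x mod L = (x + 2) mod L" using mod_Suc_eq[of "Suc x" L] mod_Suc_eq[of y L] by simp
        then have "L dvd 2" using mod_eq_dvd_iff_nat[of x "x + 2" L] by simp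
        then show False using L(2) dvd_imp_le[of L 2] by simp
      qed
      then show "x = x' \<and> y = y'" using *(3) unfolding doubleton_eq_iff by metis
    qed
    show "(\<lambda>(x, y). {x, y}) ` mono_pairs \<subseteq> monochromatic (edges (cycle_blowup L m)) X"
      by (auto simp: mono_pairs_def monochromatic_def cycle_blowup_def)
    have "edges (cycle_blowup L m) \<subseteq> Pow {..<L * m}" by (auto simp: cycle_blowup_def)
    then have "finite (edges (cycle_blowup L m))" by (rule finite_subset) simp
    then show "finite (monochromatic (edges (cycle_blowup L m)) X)"
      by (simp add: monochromatic_def)
  qed
  finally have "m ^ 2 \<le> card (monochromatic (edges (cycle_blowup L m)) X)"
    by (simp add: card_cartesian_product power2_eq_square)
  then have "real (m ^ 2) \<le> real (card (monochromatic (edges (cycle_blowup L m)) X))"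
    by (simp only: of_nat_le_iff)
  moreover have "1 / real L ^ 2 * real (card (verts (cycle_blowup L m))) ^ 2 = real (m ^ 2)"
    using L by (simp add: cycle_blowup_def power_mult_distrib)
  ultimately show "1 / real L ^ 2 * real (card (verts (cycle_blowup L m))) ^ 2
      \<le> real (card (monochromatic (edges (cycle_blowup L m)) X))" by linarith
qed

text \<open>The constant \<open>c\<close> is the same for all \<open>N\<close>, so the gap
  \<open>c - \<epsilon>\<close> fixes one sample size before a large graph is chosen.\<close>

lemma exists_far_graph:
  assumes k: "k \<ge> 1" and \<epsilon>: "\<epsilon> < 1 / (4 * real k ^ 2)"
  obtains c where "\<epsilon> < c"
    and "\<And>N. \<exists>G. simple_graph G \<and> N \<le> card (verts G) \<and> far_from_bipartite c G \<and>
           (\<forall>T\<subseteq>verts G. card T \<le> k \<longrightarrow> two_colourable (edges G) T)"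
proof (cases "k = 1")
  case True
  define c where "c = (\<epsilon> + 1 / 4) / 2"
  have c: "\<epsilon> < c" "c < 1 / 4" using \<epsilon> True by (auto simp: c_def)
  show ?thesis
  proof (rule that[OF c(1)])
    fix N
    obtain n where n: "n \<ge> N"
      and far: "far_from_bipartite c ({..<n}, {e. e \<subseteq> {..<n} \<and> card e = 2})" (is "far_from_bipartite c ?G")
      using far_complete_graph[OF c(2)] by blast
    have "two_colourable (edges ?G) T" if "T \<subseteq> verts ?G" "card T \<le> k" for T
    proof -
      have "finite T" using that(1) by (auto intro: finite_subset)
      then have "x = y" if "x \<in> T" "y \<in> T" for x y
        using \<open>card T \<le> k\<close> True that by (simp add: card_le_Suc0_iff_eq)
      then have "{x, y} \<notin> edges ?G" if "x \<in> T" "y \<in> T" for x y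
        using that by fastforce
      then show ?thesis unfolding two_colourable_def by (intro exI ballI impI) metis
    qed
    moreover have "simple_graph ?G" by (simp add: simple_graph_def)
    ultimately show "\<exists>G. simple_graph G \<and> N \<le> card (verts G) \<and> far_from_bipartite c G \<and>
        (\<forall>T\<subseteq>verts G. card T \<le> k \<longrightarrow> two_colourable (edges G) T)"
      using n far by (intro exI[of _ ?G]) simp
  qed
next
  case False
  \<comment> \<open>The largest odd length below \<open>2 * k\<close>, so that
    \<open>1 / L ^ 2 > 1 / (4 * k ^ 2)\<close>. It exceeds \<open>k\<close> only for
    \<open>k \<ge> 2\<close>, hence the separate case \<open>k = 1\<close>.\<close>
  define L where "L = 2 * k - 1"
  have L: "odd L" "L \<ge> 3" "k < L" "L < 2 * k" using k False by (auto simp: L_def)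
  have "real L ^ 2 < (2 * real k) ^ 2" using L by (intro power_strict_mono) auto
  then have "1 / (4 * real k ^ 2) < 1 / real L ^ 2"
    using L by (intro divide_strict_left_mono) (auto simp: power_mult_distrib)
  then have c: "\<epsilon> < 1 / real L ^ 2" using \<epsilon> by simp
  show ?thesis
  proof (rule that[OF c])
    fix N
    let ?G = "cycle_blowup L N"
    have "two_colourable (edges ?G) T" if "T \<subseteq> verts ?G" "card T \<le> k" for T
      using that L by (intro two_colourable_cycle_blowup) (auto simp: cycle_blowup_def intro: finite_subset)
    moreover have "N \<le> card (verts ?G)" using L by (simp add: cycle_blowup_def)
    ultimately show "\<exists>G. simple_graph G \<and> N \<le> card (verts G) \<and> far_from_bipartite (1 / real L ^ 2) G \<and>
        (\<forall>T\<subseteq>verts G. card T \<le> k \<longrightarrow> two_colourable (edges G) T)"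
      using simple_cycle_blowup[of L N] far_cycle_blowup[OF L(1,2), of N] L by (intro exI[of _ ?G]) simp
  qed
qed

section \<open>The sample complexities\<close>

text \<open>If \<open>h w \<le> k\<close>, the property inspects a sample of \<open>w\<close>
  vertices only on sets of at most \<open>k\<close> vertices. In the graphs of
  \<open>exists_far_graph\<close> these are bipartite, so no sample reveals a violation.\<close>

lemma less_if_one_sided_sample:
  assumes h: "\<And>K. \<forall>\<^sub>F n in sequentially. K \<le> h n"
    and k: "k \<ge> 1" "\<epsilon> < 1 / (4 * real k ^ 2)"
    and "one_sided_sample (locally_bipartite h) \<epsilon> w"
  shows "k < h w"
proof (rule ccontr)
  assume hw: "\<not> k < h w"
  obtain c where c: "\<epsilon> < c" and ex: "\<And>N. \<exists>G. simple_graph G \<and> N \<le> card (verts G) \<and>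
      far_from_bipartite c G \<and> (\<forall>T\<subseteq>verts G. card T \<le> k \<longrightarrow> two_colourable (edges G) T)"
    using exists_far_graph[OF k] by blast
  obtain N where N: "N \<ge> w" "\<And>G. simple_graph G \<Longrightarrow> N \<le> card (verts G) \<Longrightarrow>
      eps_far (locally_bipartite h) \<epsilon> G \<Longrightarrow>
      2 / 3 \<le> measure_pmf.prob (random_vertices G w) {S. \<not> locally_bipartite h (induced G S)}"
    using assms(4) unfolding one_sided_sample_def by blast
  obtain M where M: "\<And>n. n \<ge> M \<Longrightarrow> sample_size (c - \<epsilon>) \<le> h n"
    using h[of "sample_size (c - \<epsilon>)"] by (auto simp: eventually_sequentially)
  \<comment> \<open>The order must exceed the tester's threshold \<open>N\<close>, the point
    \<open>M\<close> from which \<open>h\<close> is large, and the size needed for sampling; the 1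
    makes the graph nonempty.\<close>
  obtain G where G: "simple_graph G" "far_from_bipartite c G"
    and n: "N + M + 2 * sample_size (c - \<epsilon>) ^ 2 + 1 \<le> card (verts G)"
    and col: "\<And>T. T \<subseteq> verts G \<Longrightarrow> card T \<le> k \<Longrightarrow> two_colourable (edges G) T"
    using ex[of "N + M + 2 * sample_size (c - \<epsilon>) ^ 2 + 1"] by blast
  have fin: "finite (verts G)" using G by (simp add: simple_graph_def)
  have "eps_far (locally_bipartite h) \<epsilon> G"
    using G c n M[of "card (verts G)"] by (intro eps_far_locally_bipartite) auto
  then have "2 / 3 \<le> measure_pmf.prob (random_vertices G w) {S. \<not> locally_bipartite h (induced G S)}"
    using N(2)[of G] G n by simp
  moreover have "locally_bipartite h (induced G S)" if "S \<subseteq> verts G" "card S = w" for S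
    unfolding locally_bipartite_def
  proof (intro allI impI)
    fix T assume "T \<subseteq> verts (induced G S)" "card T \<le> h (card (verts (induced G S)))"
    then have "T \<subseteq> S" "card T \<le> k" using hw that by (simp_all add: induced_def)
    then show "two_colourable (edges (induced G S)) T"
      using col that two_colourable_induced[of T S G] by auto
  qed
  then have "measure_pmf.prob (random_vertices G w) {S. \<not> locally_bipartite h (induced G S)} = 0"
    using set_pmf_random_vertices[OF fin, of w] N(1) n
    by (auto simp: measure_pmf_zero_iff)
  ultimately show False by simp
qed

text \<open>The half-open intervals between consecutive values \<open>1 / (4 * k ^ 2)\<close> cover
  \<open>(0, 1 / 4)\<close>; the least \<open>k\<close> whose lower end is at most
  \<open>\<epsilon>\<close> is the right one.\<close>

lemma reciprocal_squares_bracket: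
  assumes "0 < \<epsilon>" "\<epsilon> < (1 :: real) / 4"
  obtains k :: nat where "k \<ge> 1" "1 / (4 * real (Suc k) ^ 2) \<le> \<epsilon>" "\<epsilon> < 1 / (4 * real k ^ 2)"
proof -
  let ?Q = "\<lambda>k :: nat. 1 / (4 * real (Suc k) ^ 2) \<le> \<epsilon>"
  obtain m :: nat where "inverse (real (Suc m)) < \<epsilon>" using reals_Archimedean[OF assms(1)] by blast
  moreover have "1 / (4 * real (Suc m) ^ 2) \<le> 1 / real (Suc m)"
    by (rule divide_left_mono) (auto simp: power2_eq_square)
  ultimately have "?Q m" by (simp add: inverse_eq_divide)
  then have Q: "?Q (Least ?Q)" by (rule LeastI)
  then have "Least ?Q \<noteq> 0" using assms(2) by (intro notI) simp
  then obtain j where j: "Least ?Q = Suc j" using not0_implies_Suc by blast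
  then have "\<not> ?Q j" by (intro not_less_Least) simp
  then show thesis using that[of "Least ?Q"] Q j by simp
qed

text \<open>Finiteness ensures that the lower bound concerns an actual sample size. The range ends
  at \<open>1 / 4\<close> because some cut leaves at most half of the edges monochromatic, fewer
  than \<open>n ^ 2 / 4\<close>, so no nonempty graph is farther from the property constructed
  here.\<close>

theorem theorem5:
  fixes f :: "real \<Rightarrow> nat"
  assumes "antimono_on {0<..<1} f"
    and "\<And>x. x \<in> {0<..<1} \<Longrightarrow> real (f x) \<ge> 1 / x"
  shows "\<exists>P. monotone_graph_property P \<and>
    (\<forall>\<epsilon>\<in>{0<..<1}. one_sided_complexity P \<epsilon> \<noteq> \<infinity>) \<and>
    (\<forall>\<epsilon>\<in>{0<..<1/4}. enat (f \<epsilon>) \<le> one_sided_complexity P \<epsilon>) \<and>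
    (\<exists>(p :: real poly) (n0 :: real \<Rightarrow> nat). \<forall>\<epsilon>\<in>{0<..<1}. \<forall>n\<ge>n0 \<epsilon>.
       real (two_sided_complexity P \<epsilon> n) \<le> poly p (1 / \<epsilon>))"
proof -
  define c :: "nat \<Rightarrow> real" where "c k = 1 / (4 * real (Suc k) ^ 2)" for k
  \<comment> \<open>A generalised inverse of \<open>k \<mapsto> f (c k)\<close>: the faster
    \<open>f\<close> grows near 0, the slower \<open>h\<close> grows.\<close>
  define h where "h n = (LEAST k. n < f (c k))" for n
  have c: "0 < c k" "c k < 1" for k
  proof -
    have "1 \<le> real (Suc k) ^ 2" by (rule one_le_power) simp
    then have "1 < 4 * real (Suc k) ^ 2" by linarith
    then show "0 < c k" "c k < 1" unfolding c_def by simp_all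
  qed
  have c_mono: "f (c j) \<le> f (c k)" if "j \<le> k" for j k
  proof -
    have "real (Suc j) ^ 2 \<le> real (Suc k) ^ 2" using that by (intro power_mono) auto
    then have "c k \<le> c j" unfolding c_def by (intro divide_left_mono) auto
    then show ?thesis using assms(1) c by (auto simp: monotone_on_def)
  qed
  \<comment> \<open>The bound \<open>f x \<ge> 1 / x\<close> makes \<open>f (c k)\<close> unbounded,
    so the minimum defining \<open>h\<close> exists.\<close>
  have f_large: "n < f (c n)" for n
  proof -
    have "real n < real (Suc n) * 4 * real (Suc n)"
      by (simp add: algebra_simps add_pos_nonneg)
    also have "\<dots> = 1 / c n" by (simp add: c_def power2_eq_square)
    also have "\<dots> \<le> real (f (c n))" using assms(2)[of "c n"] c by simp
    finally show ?thesis by simp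
  qed
  have h: "n < f (c (h n))" for n unfolding h_def by (rule LeastI) (rule f_large)
  have h_le: "h n \<le> k" if "n < f (c k)" for n k unfolding h_def using that by (rule Least_le)
  have "mono h"
  proof (rule monoI)
    fix m n :: nat assume "m \<le> n"
    then show "h m \<le> h n" using h[of n] by (intro h_le) simp
  qed
  have h_unbounded: "\<forall>\<^sub>F n in sequentially. K \<le> h n" for K
    unfolding eventually_sequentially
  proof (intro exI[of _ "f (c K)"] allI impI)
    fix n assume n: "f (c K) \<le> n"
    show "K \<le> h n"
    proof (rule ccontr)
      assume "\<not> K \<le> h n"
      then have "f (c (h n)) \<le> f (c K)" by (intro c_mono) simp
      then show False using h[of n] n by simp
    qed
  qed
  let ?P = "locally_bipartite h"
  show ?thesis
  proof (intro exI[of _ ?P] conjI ballI)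
    show "monotone_graph_property ?P" using \<open>mono h\<close> by (rule monotone_locally_bipartite)
  next
    fix \<epsilon> :: real assume \<epsilon>: "\<epsilon> \<in> {0<..<1}"
    have "\<forall>\<^sub>F w in sequentially. sample_size \<epsilon> \<le> h w \<and> max 1 (sample_size \<epsilon>) \<le> w"
      using h_unbounded eventually_ge_at_top by (rule eventually_conj)
    then obtain w where w: "sample_size \<epsilon> \<le> h w" "max 1 (sample_size \<epsilon>) \<le> w"
      by (auto simp: eventually_sequentially)
    then have "one_sided_sample ?P \<epsilon> w"
      using \<epsilon> by (intro one_sided_sample_locally_bipartite) auto
    then have "one_sided_complexity ?P \<epsilon> \<le> enat w"
      unfolding one_sided_complexity_def using w by (intro Inf_lower) auto
    then show "one_sided_complexity ?P \<epsilon> \<noteq> \<infinity>" by (metis infinity_ileE)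
  next
    fix \<epsilon> :: real assume \<epsilon>: "\<epsilon> \<in> {0<..<1/4}"
    obtain k where k: "k \<ge> 1" "c k \<le> \<epsilon>" "\<epsilon> < 1 / (4 * real k ^ 2)"
      using reciprocal_squares_bracket[of \<epsilon>] \<epsilon> unfolding c_def by auto
    have "f \<epsilon> \<le> w" if "one_sided_sample ?P \<epsilon> w" for w
    proof -
      have "k < h w" using less_if_one_sided_sample[OF h_unbounded k(1,3) that] .
      \<comment> \<open>Since \<open>k\<close> lies below the minimum \<open>h w\<close>, it fails
        the condition \<open>w < f (c k)\<close>.\<close>
      then have "f (c k) \<le> w" using h_le[of w k] by linarith
      moreover have "f \<epsilon> \<le> f (c k)"
        using assms(1) k(2) c \<epsilon> by (auto simp: monotone_on_def)
      ultimately show ?thesis by simp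
    qed
    then show "enat (f \<epsilon>) \<le> one_sided_complexity ?P \<epsilon>"
      unfolding one_sided_complexity_def by (intro Inf_greatest) auto
  next
    \<comment> \<open>All dependence on \<open>f\<close> is absorbed by this threshold, through
      \<open>h\<close>; the polynomial is the same for every \<open>f\<close>.\<close>
    define n0 where "n0 \<epsilon> = (SOME N. \<forall>n\<ge>N. sample_size \<epsilon> \<le> h n \<and>
      max 1 (2 * sample_size \<epsilon> ^ 2) \<le> n)" for \<epsilon>
    have n0: "sample_size \<epsilon> \<le> h n \<and> max 1 (2 * sample_size \<epsilon> ^ 2) \<le> n" if "n0 \<epsilon> \<le> n" for \<epsilon> n
    proof -
      have "\<forall>\<^sub>F n in sequentially. sample_size \<epsilon> \<le> h n \<and> max 1 (2 * sample_size \<epsilon> ^ 2) \<le> n"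
        using h_unbounded eventually_ge_at_top by (rule eventually_conj)
      then have "\<forall>n\<ge>n0 \<epsilon>. sample_size \<epsilon> \<le> h n \<and> max 1 (2 * sample_size \<epsilon> ^ 2) \<le> n"
        unfolding eventually_sequentially n0_def by (rule someI_ex)
      then show ?thesis using that by blast
    qed
    have "real (two_sided_complexity ?P \<epsilon> n) \<le> poly [:3, 64, 192:] (1 / \<epsilon>)"
      if "\<epsilon> \<in> {0<..<1}" "n0 \<epsilon> \<le> n" for \<epsilon> n
    proof -
      have "two_sided_complexity ?P \<epsilon> n \<le> sample_size \<epsilon>"
        using n0[OF that(2)] that(1) \<open>mono h\<close> by (intro two_sided_complexity_le) auto
      then show ?thesis using sample_size_le[of \<epsilon>] that(1) by simp
    qed
    then show "\<exists>(p :: real poly) (n0 :: real \<Rightarrow> nat). \<forall>\<epsilon>\<in>{0<..<1}. \<forall>n\<ge>n0 \<epsilon>.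
       real (two_sided_complexity ?P \<epsilon> n) \<le> poly p (1 / \<epsilon>)" by blast
  qed
qed

end
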